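(* Let $\mathcal{N}=(N,m_0,M_f)$ be a bounded, livelock-free labelled stochastic process (LSP), assumed complete. Then $\sum_{\eta\text{ run of }\mathcal{N}}\mathbb{P}_{\mathcal{N}}(\eta)=1$, i.e. the outcome probability of the full set $M_f$ of final markings equals $1$.
   Context: Fix a finite set $\mathcal{A}$ of task names and a silent label $\tau\notin\mathcal{A}$; $\Sigma=\mathcal{A}\cup\{\tau\}$. An LGSPN is $N=(Q,T,F,\ell,w)$ with finite disjoint sets $Q$ (places) and $T$ (transitions), flow relation $F\subseteq(Q\times T)\cup(T\times Q)$, labelling $\ell:T\to\Sigma$, $T$ partitioned into immediate transitions $T^{im}$ and timed transitions $T^{ti}$, and weights $w:T\to\mathbb{R}^{+}$. A marking is a multiset of places; ${}^\bullet t$, $t^\bullet$ are the input and output places of $t$. $t$ is enabled in $m$ if ${}^\bullet t\le m$ and either $t\in T^{im}$ or no immediate $t'$ has ${}^\bullet t'\le m$; firing gives $m'=(m-{}^\bullet t)+t^\bullet$. A deadlock marking enables no transition. An LSP is $\mathcal{N}=(N,m_0,M_f)$ with $M_f$ a finite set of deadlock markings; complete means $M_f$ equals the set of deadlock markings reachable from $m_0$. A run is a finite sequence $t_0,\dots,t_n$ fired successively from $m_0$ through markings $m_0,\dots,m_{n+1}$ with $m_{n+1}\in M_f$; its probability $\mathbb{P}_{\mathcal{N}}(\eta)$ is the product over $i$ of the firing probability of $t_i$ in $m_i$, where the firing probability of $t$ in $m$ is $w(t)/\sum_{t'\text{ enabled in }m}w(t')$ if $t$ is enabled and $0$ otherwise.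 $\mathcal{N}$ is bounded if the number of tokens in each place over all reachable markings is bounded. A reachable marking is a livelock marking if it is not a deadlock and no firing sequence from it reaches a deadlock; livelock-free means there is no such marking. *)

theory Defs
  imports "HOL-Analysis.Analysis" "HOL-Library.Multiset"
begin

text \<open>Places and transitions are drawn from one common type of nodes, so that the flow relation
  is a single relation and the disjointness of the two node sets is an actual condition.\<close>

record ('v, 'a) net =
  places :: "'v set"
  transitions :: "'v set"
  flow :: "('v \<times> 'v) set"
  label :: "'v \<Rightarrow> 'a"
  immediate :: "'v set"
  timed :: "'v set"
  weight :: "'v \<Rightarrow> real"

definition lgspn :: "'a set \<Rightarrow> 'a \<Rightarrow> ('v, 'a) net \<Rightarrow> bool" where
  "lgspn A \<tau> N \<longleftrightarrow>
     finite A \<and> \<tau> \<notin> A \<and>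
     finite (places N) \<and> finite (transitions N) \<and> places N \<inter> transitions N = {} \<and>
     flow N \<subseteq> (places N \<times> transitions N) \<union> (transitions N \<times> places N) \<and>
     (\<forall>t \<in> transitions N. label N t \<in> A \<union> {\<tau>}) \<and>
     immediate N \<union> timed N = transitions N \<and> immediate N \<inter> timed N = {} \<and>
     (\<forall>t \<in> transitions N. weight N t > 0)"

type_synonym 'v marking = "'v multiset"

definition is_marking :: "('v, 'a) net \<Rightarrow> 'v marking \<Rightarrow> bool" where
  "is_marking N m \<longleftrightarrow> set_mset m \<subseteq> places N"

definition inputs :: "('v, 'a) net \<Rightarrow> 'v \<Rightarrow> 'v marking" where
  "inputs N t = mset_set {q \<in> places N. (q, t) \<in> flow N}"

definition outputs :: "('v, 'a) net \<Rightarrow> 'v \<Rightarrow> 'v marking" where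
  "outputs N t = mset_set {q \<in> places N. (t, q) \<in> flow N}"

definition enabled :: "('v, 'a) net \<Rightarrow> 'v marking \<Rightarrow> 'v \<Rightarrow> bool" where
  "enabled N m t \<longleftrightarrow>
     t \<in> transitions N \<and> inputs N t \<subseteq># m \<and>
     (t \<in> immediate N \<or> \<not> (\<exists>t' \<in> immediate N. inputs N t' \<subseteq># m))"

definition fire :: "('v, 'a) net \<Rightarrow> 'v marking \<Rightarrow> 'v \<Rightarrow> 'v marking" where
  "fire N m t = (m - inputs N t) + outputs N t"

definition deadlock :: "('v, 'a) net \<Rightarrow> 'v marking \<Rightarrow> bool" where
  "deadlock N m \<longleftrightarrow> is_marking N m \<and> \<not> (\<exists>t. enabled N m t)"

definition marking_after :: "('v, 'a) net \<Rightarrow> 'v marking \<Rightarrow> 'v list \<Rightarrow> 'v marking" where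
  "marking_after N m ts = foldl (fire N) m ts"

definition firing_sequence :: "('v, 'a) net \<Rightarrow> 'v marking \<Rightarrow> 'v list \<Rightarrow> bool" where
  "firing_sequence N m ts \<longleftrightarrow>
     (\<forall>i < length ts. enabled N (marking_after N m (take i ts)) (ts ! i))"

definition reachable :: "('v, 'a) net \<Rightarrow> 'v marking \<Rightarrow> 'v marking \<Rightarrow> bool" where
  "reachable N m m' \<longleftrightarrow> (\<exists>ts. firing_sequence N m ts \<and> marking_after N m ts = m')"

definition lsp :: "'a set \<Rightarrow> 'a \<Rightarrow> ('v, 'a) net \<Rightarrow> 'v marking \<Rightarrow> 'v marking set \<Rightarrow> bool" where
  "lsp A \<tau> N m0 Mf \<longleftrightarrow>
     lgspn A \<tau> N \<and> is_marking N m0 \<and> finite Mf \<and> (\<forall>m \<in> Mf. deadlock N m)"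

definition complete_lsp :: "('v, 'a) net \<Rightarrow> 'v marking \<Rightarrow> 'v marking set \<Rightarrow> bool" where
  "complete_lsp N m0 Mf \<longleftrightarrow> Mf = {m. reachable N m0 m \<and> deadlock N m}"

definition bounded_net :: "('v, 'a) net \<Rightarrow> 'v marking \<Rightarrow> bool" where
  "bounded_net N m0 \<longleftrightarrow>
     (\<forall>q \<in> places N. \<exists>k::nat. \<forall>m. reachable N m0 m \<longrightarrow> count m q \<le> k)"

definition livelock :: "('v, 'a) net \<Rightarrow> 'v marking \<Rightarrow> 'v marking \<Rightarrow> bool" where
  "livelock N m0 m \<longleftrightarrow>
     reachable N m0 m \<and> \<not> deadlock N m \<and> \<not> (\<exists>m'. reachable N m m' \<and> deadlock N m')"

definition livelock_free :: "('v, 'a) net \<Rightarrow> 'v marking \<Rightarrow> bool" where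
  "livelock_free N m0 \<longleftrightarrow> \<not> (\<exists>m. livelock N m0 m)"

definition firing_prob :: "('v, 'a) net \<Rightarrow> 'v marking \<Rightarrow> 'v \<Rightarrow> real" where
  "firing_prob N m t =
     (if enabled N m t then weight N t / (\<Sum>t' \<in> {t'. enabled N m t'}. weight N t') else 0)"

text \<open>The empty sequence is a run exactly when the initial marking is itself final; its
  probability is the empty product.\<close>

definition runs :: "('v, 'a) net \<Rightarrow> 'v marking \<Rightarrow> 'v marking set \<Rightarrow> 'v list set" where
  "runs N m0 Mf = {ts. firing_sequence N m0 ts \<and> marking_after N m0 ts \<in> Mf}"

definition run_prob :: "('v, 'a) net \<Rightarrow> 'v marking \<Rightarrow> 'v list \<Rightarrow> real" where
  "run_prob N m0 ts = (\<Prod>i < length ts. firing_prob N (marking_after N m0 (take i ts)) (ts ! i))"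

definition outcome_prob ::
  "('v, 'a) net \<Rightarrow> 'v marking \<Rightarrow> 'v marking set \<Rightarrow> 'v marking set \<Rightarrow> real" where
  "outcome_prob N m0 Mf M =
     (\<Sum>\<^sub>\<infinity> ts \<in> {ts \<in> runs N m0 Mf. marking_after N m0 ts \<in> M}. run_prob N m0 ts)"

end

theory Submission
  imports Defs
begin

text \<open>Let \<open>live_prob N n m\<close> be the probability that, starting in \<open>m\<close>, a non-deadlocked marking is
  reached after exactly \<open>n\<close> firings. The runs of length at most \<open>n\<close> then have total probability
  \<open>1 - live_prob N n m\<close>. Livelock-freeness gives, from every reachable marking, a path to a deadlock,
  and boundedness makes the set of reachable markings finite; hence a fixed number of steps
  multiplies the survival probability by a fixed factor below 1, and it decays geometrically.\<close>

primrec live_prob :: "('v, 'a) net \<Rightarrow> nat \<Rightarrow> 'v marking \<Rightarrow> real" where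
  "live_prob N 0 m = (if \<exists>t. enabled N m t then 1 else 0)"
| "live_prob N (Suc n) m =
     (\<Sum>t \<in> {t. enabled N m t}. firing_prob N m t * live_prob N n (fire N m t))"

text \<open>The end is tested by the absence of enabled transitions, without \<open>Mf\<close> or
  \<open>is_marking\<close>, so that first-step inductions carry no side conditions.\<close>

definition terminating_sequences :: "('v, 'a) net \<Rightarrow> nat \<Rightarrow> 'v marking \<Rightarrow> 'v list set" where
  "terminating_sequences N n m =
     {ts. firing_sequence N m ts \<and> \<not> (\<exists>t. enabled N (marking_after N m ts) t) \<and> length ts \<le> n}"

section \<open>Firing sequences, split at the first transition\<close>

lemma marking_after_simps [simp]:
  "marking_after N m [] = m"
  "marking_after N m (t # ts) = marking_after N (fire N m t) ts"
  by (simp_all add: marking_after_def)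

lemma firing_sequence_Nil [simp]: "firing_sequence N m []"
  by (simp add: firing_sequence_def)

lemma firing_sequence_Cons [simp]:
  "firing_sequence N m (t # ts) \<longleftrightarrow> enabled N m t \<and> firing_sequence N (fire N m t) ts"
  by (auto simp: firing_sequence_def All_less_Suc2)

lemma run_prob_Nil [simp]: "run_prob N m [] = 1"
  by (simp add: run_prob_def)

lemma run_prob_Cons [simp]:
  "run_prob N m (t # ts) = firing_prob N m t * run_prob N (fire N m t) ts"
  by (simp add: run_prob_def prod.lessThan_Suc_shift del: prod.lessThan_Suc)

lemma reachable_refl: "reachable N m m"
  unfolding reachable_def by (rule exI[of _ "[]"]) simp

lemma marking_after_append:
  "marking_after N m (ts @ us) = marking_after N (marking_after N m ts) us"
  by (simp add: marking_after_def)

lemma firing_sequence_append: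
  "firing_sequence N m (ts @ us) \<longleftrightarrow>
     firing_sequence N m ts \<and> firing_sequence N (marking_after N m ts) us"
  by (induction ts arbitrary: m) auto

lemma reachable_fire:
  assumes "reachable N m0 m" and "enabled N m t"
  shows "reachable N m0 (fire N m t)"
proof -
  obtain ts where "firing_sequence N m0 ts" "marking_after N m0 ts = m"
    using assms(1) by (auto simp: reachable_def)
  then show ?thesis
    unfolding reachable_def using assms(2)
    by (intro exI[of _ "ts @ [t]"]) (simp add: firing_sequence_append marking_after_append)
qed

section \<open>A single firing: markings and probabilities\<close>

context
  fixes A :: "'a set" and \<tau> :: 'a and N :: "('v, 'a) net"
  assumes N: "lgspn A \<tau> N"
begin

lemma finite_enabled [simp]: "finite {t. enabled N m t}"
  by (rule finite_subset[of _ "transitions N"]) (use N in \<open>auto simp: lgspn_def enabled_def\<close>)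

lemma weight_pos: "enabled N m t \<Longrightarrow> weight N t > 0"
  using N by (auto simp: lgspn_def enabled_def)

lemma is_marking_fire: "is_marking N m \<Longrightarrow> is_marking N (fire N m t)"
  using N by (auto simp: is_marking_def fire_def outputs_def lgspn_def dest: in_diffD)

lemma is_marking_marking_after: "is_marking N m \<Longrightarrow> is_marking N (marking_after N m ts)"
  by (induction ts arbitrary: m) (auto simp: is_marking_fire)

lemma sum_weight_pos: "enabled N m t \<Longrightarrow> (\<Sum>t \<in> {t. enabled N m t}. weight N t) > 0"
  by (rule sum_pos) (auto intro: weight_pos)

lemma firing_prob_pos: "enabled N m t \<Longrightarrow> firing_prob N m t > 0"
  by (simp add: firing_prob_def weight_pos sum_weight_pos)

lemma firing_prob_nonneg: "firing_prob N m t \<ge> 0"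
  using firing_prob_pos[of m t] by (cases "enabled N m t") (auto simp: firing_prob_def)

lemma sum_firing_prob:
  assumes "enabled N m t"
  shows "(\<Sum>t \<in> {t. enabled N m t}. firing_prob N m t) = 1"
proof -
  have "(\<Sum>t \<in> {t. enabled N m t}. firing_prob N m t) =
      (\<Sum>t \<in> {t. enabled N m t}. weight N t / (\<Sum>t \<in> {t. enabled N m t}. weight N t))"
    by (rule sum.cong) (auto simp: firing_prob_def)
  also have "\<dots> = 1"
    using sum_weight_pos[OF assms] by (simp flip: sum_divide_distrib)
  finally show ?thesis .
qed

lemma sum_firing_prob_le_1: "(\<Sum>t \<in> {t. enabled N m t}. firing_prob N m t) \<le> 1"
proof (cases "\<exists>t. enabled N m t")
  case True
  then show ?thesis using sum_firing_prob by fastforce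
qed simp

lemma run_prob_nonneg: "run_prob N m ts \<ge> 0"
  by (simp add: run_prob_def prod_nonneg firing_prob_nonneg)

section \<open>Survival probability\<close>

lemma live_prob_nonneg: "live_prob N n m \<ge> 0"
  by (induction n arbitrary: m) (auto intro!: sum_nonneg mult_nonneg_nonneg firing_prob_nonneg)

lemma live_prob_le_1: "live_prob N n m \<le> 1"
proof (induction n arbitrary: m)
  case (Suc n)
  have "live_prob N (Suc n) m \<le> (\<Sum>t \<in> {t. enabled N m t}. firing_prob N m t)"
    unfolding live_prob.simps
    by (intro sum_mono mult_left_le Suc firing_prob_nonneg)
  then show ?case using sum_firing_prob_le_1[of m] by linarith
qed simp

lemma live_prob_eq_0: "\<not> (\<exists>t. enabled N m t) \<Longrightarrow> live_prob N n m = 0"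
  by (cases n) auto

text \<open>Survival of more firings implies survival of fewer. The base case compares a probability
  with 1, or 0 with 0 in a dead marking; nonnegative firing probabilities carry the inequality
  through the recursion.\<close>

lemma live_prob_antimono_Suc: "live_prob N (Suc n) m \<le> live_prob N n m"
proof (induction n arbitrary: m)
  case 0
  show ?case
    using live_prob_le_1[of "Suc 0" m] live_prob_eq_0[of m "Suc 0"]
    by (cases "\<exists>t. enabled N m t") (auto simp del: live_prob.simps(2))
next
  case (Suc n)
  show ?case
    unfolding live_prob.simps(2)[of N _ m]
    by (intro sum_mono mult_left_mono Suc firing_prob_nonneg)
qed

lemma live_prob_antimono: "k \<le> n \<Longrightarrow> live_prob N n m \<le> live_prob N k m"
  by (rule lift_Suc_antimono_le[of "\<lambda>n. live_prob N n m"]) (auto simp only: live_prob_antimono_Suc)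

text \<open>Following \<open>ts\<close> into a dead marking has positive probability: at each step
  the branch of the next transition of \<open>ts\<close> falls strictly short of its firing
  probability, and the other branches are bounded by theirs.\<close>

lemma live_prob_less_1:
  assumes "firing_sequence N m ts" and "\<not> (\<exists>t. enabled N (marking_after N m ts) t)"
  shows "live_prob N (length ts) m < 1"
  using assms
proof (induction ts arbitrary: m)
  case (Cons t ts)
  then have t: "enabled N m t" and less: "live_prob N (length ts) (fire N m t) < 1"
    by auto
  have "live_prob N (length (t # ts)) m < (\<Sum>t \<in> {t. enabled N m t}. firing_prob N m t)"
    unfolding live_prob.simps list.size(4) add_Suc_right add_0_right One_nat_def
  proof (rule sum_strict_mono_ex1)
    show "\<forall>u \<in> {t. enabled N m t}.
        firing_prob N m u * live_prob N (length ts) (fire N m u) \<le> firing_prob N m u"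
      by (intro ballI mult_left_le live_prob_le_1 firing_prob_nonneg)
    show "\<exists>u \<in> {t. enabled N m t}.
        firing_prob N m u * live_prob N (length ts) (fire N m u) < firing_prob N m u"
      using t less firing_prob_pos[OF t] by (intro bexI[of _ t]) auto
  qed simp
  then show ?case using sum_firing_prob[OF t] by linarith
qed simp

section \<open>Terminating sequences of bounded length\<close>

lemma terminating_sequences_Suc:
  assumes "enabled N m t"
  shows "terminating_sequences N (Suc n) m =
    (\<Union>u \<in> {t. enabled N m t}. (#) u ` terminating_sequences N n (fire N m u))"
proof (rule set_eqI)
  fix ts
  show "ts \<in> terminating_sequences N (Suc n) m \<longleftrightarrow>
    ts \<in> (\<Union>u \<in> {t. enabled N m t}. (#) u ` terminating_sequences N n (fire N m u))"
    using assms by (cases ts) (auto simp: terminating_sequences_def)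
qed

lemma terminating_sequences_deadlock:
  assumes "\<not> (\<exists>t. enabled N m t)"
  shows "terminating_sequences N n m = {[]}"
proof (rule set_eqI)
  fix ts
  show "ts \<in> terminating_sequences N n m \<longleftrightarrow> ts \<in> {[]}"
    using assms by (cases ts) (auto simp: terminating_sequences_def)
qed

lemma terminating_sequences_0:
  assumes "enabled N m t"
  shows "terminating_sequences N 0 m = {}"
  using assms by (auto simp: terminating_sequences_def)

lemma finite_terminating_sequences: "finite (terminating_sequences N n m)"
proof (induction n arbitrary: m)
  case 0
  show ?case
    by (rule finite_subset[of _ "{[]}"]) (auto simp: terminating_sequences_def)
next
  case (Suc n)
  show ?case
  proof (cases "\<exists>t. enabled N m t")
    case True
    then show ?thesis using terminating_sequences_Suc Suc by fastforce
  qed (simp add: terminating_sequences_deadlock)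
qed

text \<open>Conservation of mass: both sides obey the same first-step recursion, since the firing
  probabilities sum to 1 when some transition is enabled. In a dead marking only the empty sequence
  counts, with probability 1.\<close>

lemma sum_run_prob_terminating_sequences:
  "sum (run_prob N m) (terminating_sequences N n m) = 1 - live_prob N n m"
proof (induction n arbitrary: m)
  case 0
  show ?case
  proof (cases "\<exists>t. enabled N m t")
    case True
    then show ?thesis using terminating_sequences_0 by fastforce
  qed (simp add: terminating_sequences_deadlock)
next
  case (Suc n)
  show ?case
  proof (cases "\<exists>t. enabled N m t")
    case True
    then obtain t where t: "enabled N m t" by blast
    have "sum (run_prob N m) (terminating_sequences N (Suc n) m) =
        (\<Sum>u \<in> {t. enabled N m t}.
          sum (run_prob N m) ((#) u ` terminating_sequences N n (fire N m u)))"
      unfolding terminating_sequences_Suc[OF t]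
      by (rule sum.UNION_disjoint) (auto simp: finite_terminating_sequences)
    also have "\<dots> = (\<Sum>u \<in> {t. enabled N m t}.
        firing_prob N m u * (1 - live_prob N n (fire N m u)))"
      by (rule sum.cong) (simp_all add: sum.reindex sum_distrib_left[symmetric] Suc)
    also have "\<dots> = 1 - live_prob N (Suc n) m"
      by (simp add: right_diff_distrib sum_subtractf sum_firing_prob[OF t])
    finally show ?thesis .
  qed (simp add: terminating_sequences_deadlock)
qed

section \<open>Geometric decay of the survival probability\<close>

lemma live_prob_add_le:
  assumes "\<And>m. reachable N m0 m \<Longrightarrow> live_prob N k m \<le> c" and "reachable N m0 m"
  shows "live_prob N (n + k) m \<le> c * live_prob N n m"
  using assms(2)
\<comment> \<open>Markov property: the first \<open>n\<close> firings are peeled off, and the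
  uniform bound applies at the reachable marking then attained. At 0 the factor
  \<open>live_prob N 0 m\<close> is 1, which leaves the bound itself, or 0, and then the left side
  vanishes too.\<close>
proof (induction n arbitrary: m)
  case 0
  then show ?case using assms(1) live_prob_eq_0[of m k] by auto
next
  case (Suc n)
  have "live_prob N (Suc n + k) m \<le>
      (\<Sum>t \<in> {t. enabled N m t}. firing_prob N m t * (c * live_prob N n (fire N m t)))"
    unfolding add_Suc live_prob.simps
    by (intro sum_mono mult_left_mono Suc.IH reachable_fire[OF Suc.prems] firing_prob_nonneg) simp
  also have "\<dots> = c * live_prob N (Suc n) m"
    by (simp add: sum_distrib_left mult.left_commute)
  finally show ?case .
qed

text \<open>Finiteness makes pointwise bounds uniform: by antimonotonicity the largest of the
  finitely many horizons serves every marking, and the largest of finitely many values below 1 is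
  below 1.\<close>

lemma live_prob_uniform_less_1:
  assumes "finite {m. reachable N m0 m}"
    and "\<And>m. reachable N m0 m \<Longrightarrow> \<exists>k. live_prob N k m < 1"
  obtains k c where "0 \<le> c" "c < 1" "\<And>m. reachable N m0 m \<Longrightarrow> live_prob N k m \<le> c"
proof -
  let ?R = "{m. reachable N m0 m}"
  obtain f where f: "\<And>m. reachable N m0 m \<Longrightarrow> live_prob N (f m) m < 1"
    using assms(2) by metis
  define k where "k = Max (f ` ?R)"
  have ne: "?R \<noteq> {}" using reachable_refl by blast
  have k: "live_prob N k m < 1" if "reachable N m0 m" for m
  proof -
    have "f m \<le> k" unfolding k_def using assms(1) that by (intro Max_ge) auto
    then show ?thesis using live_prob_antimono[of "f m" k m] f[OF that] by linarith
  qed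
  show thesis
  proof (rule that[of "Max (live_prob N k ` ?R)" k])
    show "live_prob N k m \<le> Max (live_prob N k ` ?R)" if "reachable N m0 m" for m
      using assms(1) that by (intro Max_ge) auto
    then show "0 \<le> Max (live_prob N k ` ?R)"
      using live_prob_nonneg[of k m0] reachable_refl[of N m0] order_trans by blast
    show "Max (live_prob N k ` ?R) < 1"
      using assms(1) ne k by (subst Max_less_iff) auto
  qed
qed

lemma live_prob_eventually_small:
  assumes "finite {m. reachable N m0 m}"
    and "\<And>m. reachable N m0 m \<Longrightarrow> \<exists>k. live_prob N k m < 1"
    and "e > 0"
  obtains n where "live_prob N n m0 < e"
proof -
  obtain k c where c: "0 \<le> c" "c < 1"
    and le: "\<And>m. reachable N m0 m \<Longrightarrow> live_prob N k m \<le> c"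
    using live_prob_uniform_less_1[OF assms(1,2)] by blast
  \<comment> \<open>Each block of \<open>k\<close> firings costs another factor \<open>c\<close>,
    wherever the earlier blocks have led.\<close>
  have pow: "live_prob N (j * k) m0 \<le> c ^ j" for j
  proof (induction j)
    case (Suc j)
    have "live_prob N (j * k + k) m0 \<le> c * live_prob N (j * k) m0"
      by (rule live_prob_add_le[OF le reachable_refl])
    also have "\<dots> \<le> c * c ^ j"
      using Suc c(1) by (rule mult_left_mono)
    finally show ?case by (simp add: add.commute)
  qed simp
  obtain j where "c ^ j < e"
    using real_arch_pow_inv[OF assms(3) c(2)] by blast
  with pow[of j] have "live_prob N (j * k) m0 < e" by linarith
  then show thesis by (rule that)
qed

section \<open>Finite state space and summation over all runs\<close>

lemma finite_reachable:
  assumes "is_marking N m0" and "bounded_net N m0"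
  shows "finite {m. reachable N m0 m}"
proof -
  have fin: "finite (places N)" using N by (simp add: lgspn_def)
  obtain b where b: "\<And>q m. q \<in> places N \<Longrightarrow> reachable N m0 m \<Longrightarrow> count m q \<le> b q"
    using assms(2) unfolding bounded_net_def by metis
  \<comment> \<open>Bounds on the single places add up to a bound on the total number of tokens, and
    a finite set carries only finitely many multisets of each size.\<close>
  have "m \<in> (\<Union>n \<le> sum b (places N). multisets_of_size (places N) n)" if "reachable N m0 m" for m
  proof -
    have m: "set_mset m \<subseteq> places N"
      using that is_marking_marking_after[OF assms(1)]
      by (auto simp: reachable_def is_marking_def)
    have "size m = sum (count m) (set_mset m)"
      by (rule size_multiset_overloaded_eq)
    also have "\<dots> \<le> sum (count m) (places N)"
      using fin m by (intro sum_mono2) auto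
    also have "\<dots> \<le> sum b (places N)"
      by (intro sum_mono b that)
    finally show ?thesis using m by (simp add: multisets_of_size_def)
  qed
  then have "{m. reachable N m0 m} \<subseteq> (\<Union>n \<le> sum b (places N). multisets_of_size (places N) n)"
    by blast
  then show ?thesis
    by (rule finite_subset) (simp add: finite_multisets_of_size fin)
qed

text \<open>The terms are nonnegative and the stages increase to the union, with sums
  \<open>1 - live_prob N n m\<close>. So all finite sums stay at most 1, while those of the stages
  come arbitrarily close to 1.\<close>

lemma has_sum_run_prob:
  assumes "\<And>e. e > 0 \<Longrightarrow> \<exists>n. live_prob N n m < e"
  shows "(run_prob N m has_sum 1) (\<Union>n. terminating_sequences N n m)"
    (is "(_ has_sum 1) ?S")
proof -
  have le1: "sum (run_prob N m) F \<le> 1" if F: "finite F" "F \<subseteq> ?S" for F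
  proof -
    \<comment> \<open>A finite \<open>F\<close> lies in one stage, that of its longest sequence; for
      empty \<open>F\<close> any \<open>n\<close> will do.\<close>
    define n where "n = Max (length ` F)"
    have "length ts \<le> n" if "ts \<in> F" for ts
      unfolding n_def using F(1) that by (intro Max_ge) auto
    then have "F \<subseteq> terminating_sequences N n m"
      using F(2) by (auto simp: terminating_sequences_def)
    then have "sum (run_prob N m) F \<le> sum (run_prob N m) (terminating_sequences N n m)"
      by (intro sum_mono2 finite_terminating_sequences run_prob_nonneg)
    then show ?thesis
      using sum_run_prob_terminating_sequences[of m n] live_prob_nonneg[of n m] by linarith
  qed
  have summable: "run_prob N m summable_on ?S"
    by (rule nonneg_bdd_above_summable_on)
       (auto intro!: run_prob_nonneg bdd_aboveI[where M = 1] le1)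
  have "infsum (run_prob N m) ?S \<ge> 1"
  proof (rule field_le_epsilon)
    fix e :: real assume "e > 0"
    then obtain n where n: "live_prob N n m < e" using assms by blast
    have "sum (run_prob N m) (terminating_sequences N n m) \<le> infsum (run_prob N m) ?S"
      by (rule finite_sum_le_infsum[OF summable finite_terminating_sequences])
         (auto intro: run_prob_nonneg)
    then show "1 \<le> infsum (run_prob N m) ?S + e"
      using n sum_run_prob_terminating_sequences[of m n] by linarith
  qed
  moreover have "infsum (run_prob N m) ?S \<le> 1"
    using summable le1 by (rule infsum_le_finite_sums)
  ultimately show ?thesis
    using has_sum_infsum[OF summable] by simp
qed

end

theorem theorem3:
  fixes A :: "'a set" and \<tau> :: 'a
    and N :: "('v, 'a) net" and m0 :: "'v marking" and Mf :: "'v marking set"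
  assumes "lsp A \<tau> N m0 Mf"
    and "complete_lsp N m0 Mf"
    and "bounded_net N m0"
    and "livelock_free N m0"
  shows "(run_prob N m0 has_sum 1) (runs N m0 Mf) \<and> outcome_prob N m0 Mf Mf = 1"
proof -
  have N: "lgspn A \<tau> N" and m0: "is_marking N m0"
    using assms(1) by (auto simp: lsp_def)
  \<comment> \<open>Completeness makes every reachable deadlock final, and since firing preserves
    \<open>is_marking\<close>, a reached marking without enabled transitions is a deadlock.\<close>
  have runs: "runs N m0 Mf = (\<Union>n. terminating_sequences N n m0)"
    using assms(2) is_marking_marking_after[OF N m0]
    by (auto simp: runs_def complete_lsp_def deadlock_def terminating_sequences_def reachable_def)
  \<comment> \<open>A deadlock reaches itself by the empty sequence; any other reachable marking has
    a path to a deadlock because it is not a livelock.\<close>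
  have less1: "\<exists>k. live_prob N k m < 1" if m: "reachable N m0 m" for m
  proof -
    obtain m' where "reachable N m m'" "deadlock N m'"
      using assms(4) m reachable_refl[of N m] unfolding livelock_free_def livelock_def by blast
    then show ?thesis
      using live_prob_less_1[OF N, of m] by (auto simp: reachable_def deadlock_def)
  qed
  have "\<exists>n. live_prob N n m0 < e" if "e > 0" for e
    using live_prob_eventually_small[OF N finite_reachable[OF N m0 assms(3)] less1 that] by blast
  then have sum: "(run_prob N m0 has_sum 1) (runs N m0 Mf)"
    unfolding runs by (rule has_sum_run_prob[OF N])
  have "{ts \<in> runs N m0 Mf. marking_after N m0 ts \<in> Mf} = runs N m0 Mf"
    by (auto simp: runs_def)
  with sum show ?thesis
    by (simp add: outcome_prob_def infsumI)
qed

end
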